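(* Let $V$ be a finite set, let $X\in\mathrm{SCplx}_V$ be a simplicial complex over $V$, let $n\ge 1$ be an integer, and consider the functor $$F_X\colon\mathcal{P}(V)\to\mathrm{SCplx}_V,\qquad U\mapsto\mathcal{P}(U)\cap X,$$ sending $U\subseteq V$ to the subcomplex of $X$ spanned by the vertices in $U$. Then $F_X$ is codegree $n$ if and only if $X$ is $(n-1)$-skeletal.
   Context: $\mathcal{P}(V)$ is the power set of $V$ ordered by inclusion. A simplicial complex over $V$ is a subset $X\subseteq\mathcal{P}(V)$ with $\emptyset\in X$ and closed under taking subsets; $\mathrm{SCplx}_V$ is the poset of these ordered by inclusion, with join $\cup$ and meet $\cap$. An $i$-simplex of $X$ is an element $\sigma\in X$ with $|\sigma|=i+1$. $X$ is $m$-skeletal if it has no $i$-simplices for $i>m$. Codegree for functors into an ordinary cocomplete category $C$ (here a complete lattice, where colimits are joins): let $[n]=\{0,\dots,n\}$ and $\mathcal{P}_{n+1}$ the power set of $[n]$ ordered by inclusion; an $(n+1)$-cube in a category is a functor $\mathcal{X}$ out of $\mathcal{P}_{n+1}$. It is cocartesian if $\operatorname{colim}_{S\subsetneq[n]}\mathcal{X}(S)\to\mathcal{X}([n])$ is an isomorphism, cartesian if $\mathcal{X}(\emptyset)\to\lim_{\emptyset\neq S\subseteq[n]}\mathcal{X}(S)$ is an isomorphism, and strongly bicartesian if every face of dimension $\ge 2$ is both cartesian and cocartesian. A functor $F\colon P\to C$ from a lattice is codegree $n$ if it sends strongly bicartesian $(n+1)$-cubes in $P$ to cocartesian cubes in $C$.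 *)

theory Defs
  imports "HOL-Algebra.Complete_Lattice"
begin

definition incl :: "'a set set \<Rightarrow> 'a set gorder" where
  "incl \<A> = \<lparr>carrier = \<A>, eq = (=), le = (\<subseteq>)\<rparr>"

lemma incl_simps [simp]:
  "carrier (incl \<A>) = \<A>"
  "x \<sqsubseteq>\<^bsub>incl \<A>\<^esub> y \<longleftrightarrow> x \<subseteq> y"
  "x .=\<^bsub>incl \<A>\<^esub> y \<longleftrightarrow> x = y"
  by (simp_all add: incl_def)

lemma partial_order_incl: "partial_order (incl \<A>)"
  by standard (auto simp: fun_eq_iff)

(* A poset is viewed as a category; the constant isotone alone does not
   require carriers to be mapped into carriers. *)
definition poset_functor ::
    "('a, 'c) gorder_scheme \<Rightarrow> ('b, 'd) gorder_scheme \<Rightarrow> ('a \<Rightarrow> 'b) \<Rightarrow> bool" where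
  "poset_functor P C F \<longleftrightarrow> F \<in> carrier P \<rightarrow> carrier C \<and> isotone P C F"


section \<open>Cubes\<close>

(* Cubes are indexed by the subsets of an arbitrary finite set I; an (n+1)-cube
   in the strict sense is the case I = {0..n}. This lets a face of a cube be
   a cube again. *)
definition cube :: "'i set \<Rightarrow> ('b, 'd) gorder_scheme \<Rightarrow> ('i set \<Rightarrow> 'b) \<Rightarrow> bool" where
  "cube I P \<chi> \<longleftrightarrow> finite I \<and> poset_functor (incl (Pow I)) P \<chi>"

(* Colimits in a poset are least upper bounds, limits are greatest lower bounds. *)
definition cocartesian :: "'i set \<Rightarrow> ('b, 'd) gorder_scheme \<Rightarrow> ('i set \<Rightarrow> 'b) \<Rightarrow> bool" where
  "cocartesian I P \<chi> \<longleftrightarrow> least P (\<chi> I) (Upper P (\<chi> ` {S. S \<subset> I}))"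

definition cartesian :: "'i set \<Rightarrow> ('b, 'd) gorder_scheme \<Rightarrow> ('i set \<Rightarrow> 'b) \<Rightarrow> bool" where
  "cartesian I P \<chi> \<longleftrightarrow> greatest P (\<chi> {}) (Lower P (\<chi> ` {S. S \<noteq> {} \<and> S \<subseteq> I}))"

(* The restriction to the interval from A to B, a cube indexed by B - A. *)
definition face :: "'i set \<Rightarrow> ('i set \<Rightarrow> 'b) \<Rightarrow> 'i set \<Rightarrow> 'b" where
  "face A \<chi> = (\<lambda>S. \<chi> (A \<union> S))"

definition strongly_bicartesian ::
    "'i set \<Rightarrow> ('b, 'd) gorder_scheme \<Rightarrow> ('i set \<Rightarrow> 'b) \<Rightarrow> bool" where
  "strongly_bicartesian I P \<chi> \<longleftrightarrow>
     (\<forall>A B. A \<subseteq> B \<and> B \<subseteq> I \<and> card (B - A) \<ge> 2 \<longrightarrow>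
        cartesian (B - A) P (face A \<chi>) \<and> cocartesian (B - A) P (face A \<chi>))"

definition codegree ::
    "nat \<Rightarrow> ('a, 'c) gorder_scheme \<Rightarrow> ('b, 'd) gorder_scheme \<Rightarrow> ('a \<Rightarrow> 'b) \<Rightarrow> bool" where
  "codegree n P C F \<longleftrightarrow> poset_functor P C F \<and>
     (\<forall>\<chi> :: nat set \<Rightarrow> 'a. cube {0..n} P \<chi> \<and> strongly_bicartesian {0..n} P \<chi> \<longrightarrow>
        cocartesian {0..n} C (F \<circ> \<chi>))"


section \<open>Simplicial complexes\<close>

definition SCplx :: "'a set \<Rightarrow> 'a set set set" where
  "SCplx V = {X. X \<subseteq> Pow V \<and> {} \<in> X \<and> (\<forall>\<sigma>\<in>X. \<forall>\<tau>. \<tau> \<subseteq> \<sigma> \<longrightarrow> \<tau> \<in> X)}"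

definition simplex :: "nat \<Rightarrow> 'a set set \<Rightarrow> 'a set \<Rightarrow> bool" where
  "simplex i X \<sigma> \<longleftrightarrow> \<sigma> \<in> X \<and> card \<sigma> = i + 1"

definition skeletal :: "nat \<Rightarrow> 'a set set \<Rightarrow> bool" where
  "skeletal m X \<longleftrightarrow> (\<forall>i>m. \<not> (\<exists>\<sigma>. simplex i X \<sigma>))"

definition spanned :: "'a set set \<Rightarrow> 'a set \<Rightarrow> 'a set set" where
  "spanned X U = Pow U \<inter> X"

lemma Un_in_SCplx: "X \<in> SCplx V \<Longrightarrow> Y \<in> SCplx V \<Longrightarrow> X \<union> Y \<in> SCplx V"
  unfolding SCplx_def by blast

lemma Int_in_SCplx: "X \<in> SCplx V \<Longrightarrow> Y \<in> SCplx V \<Longrightarrow> X \<inter> Y \<in> SCplx V"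
  unfolding SCplx_def by blast

lemma complete_lattice_SCplx: "complete_lattice (incl (SCplx V))"
proof (rule partial_order.complete_lattice_criterion1[OF partial_order_incl])
  have top: "Pow V \<in> SCplx V"
    unfolding SCplx_def by blast
  then show "\<exists>t. greatest (incl (SCplx V)) t (carrier (incl (SCplx V)))"
    by (intro exI[of _ "Pow V"]) (simp add: greatest_def, simp add: SCplx_def)
next
  fix B assume "B \<subseteq> carrier (incl (SCplx V))" and ne: "B \<noteq> {}"
  then have B: "\<And>X. X \<in> B \<Longrightarrow> X \<in> SCplx V" by auto
  have "\<Inter>B \<in> SCplx V"
    using B ne unfolding SCplx_def by blast
  then have "greatest (incl (SCplx V)) (\<Inter>B) (Lower (incl (SCplx V)) B)"
    using B unfolding greatest_def Lower_def incl_simps by blast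
  then show "\<exists>i. greatest (incl (SCplx V)) i (Lower (incl (SCplx V)) B)" ..
qed

lemma join_SCplx:
  assumes "X \<in> SCplx V" "Y \<in> SCplx V"
  shows "X \<squnion>\<^bsub>incl (SCplx V)\<^esub> Y = X \<union> Y"
proof -
  interpret complete_lattice "incl (SCplx V)" by (rule complete_lattice_SCplx)
  show ?thesis
    using assms join_left[of X Y] join_right[of X Y] join_le[of X "X \<union> Y" Y] Un_in_SCplx[OF assms]
    by (simp add: subset_antisym)
qed

lemma meet_SCplx:
  assumes "X \<in> SCplx V" "Y \<in> SCplx V"
  shows "X \<sqinter>\<^bsub>incl (SCplx V)\<^esub> Y = X \<inter> Y"
proof -
  interpret complete_lattice "incl (SCplx V)" by (rule complete_lattice_SCplx)
  show ?thesis
    using assms meet_left[of X Y] meet_right[of X Y] meet_le[of "X \<inter> Y" X Y] Int_in_SCplx[OF assms]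
    by (simp add: subset_antisym)
qed

lemma poset_functor_spanned:
  assumes "X \<in> SCplx V"
  shows "poset_functor (incl (Pow V)) (incl (SCplx V)) (spanned X)"
proof -
  have "spanned X U \<in> SCplx V" if "U \<subseteq> V" for U
    using assms that unfolding spanned_def SCplx_def by blast
  moreover have "spanned X U \<subseteq> spanned X W" if "U \<subseteq> W" for U W
    using that unfolding spanned_def by blast
  ultimately show ?thesis
    by (auto simp: poset_functor_def isotone_def
        partial_order.axioms(1)[OF partial_order_incl])
qed

end

theory Submission
  imports Defs
begin

text \<open>
  In a strongly bicartesian cube of sets every point of the terminal vertex already occurs at a
  vertex indexed by a singleton. Hence a simplex with at most \<open>n\<close> vertices lies over a set of at
  most \<open>n\<close> indices, which is a proper subset of \<open>{0..n}\<close>. Conversely, the cube of all subsets of a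
  set of \<open>n + 1\<close> vertices is strongly bicartesian, and a simplex with exactly these vertices does
  not lie over any proper face.
\<close>

text \<open>If the union of the proper vertices belongs to \<open>\<A>\<close>, it is their join
  there, so the universal property becomes an equation of sets. This serves both
  \<open>Pow V\<close> and \<open>SCplx V\<close>.\<close>

lemma cocartesian_incl_iff:
  assumes "\<And>S. S \<subset> I \<Longrightarrow> \<chi> S \<in> \<A>" and "(\<Union>S\<in>{S. S \<subset> I}. \<chi> S) \<in> \<A>"
  shows "cocartesian I (incl \<A>) \<chi> \<longleftrightarrow> \<chi> I = (\<Union>S\<in>{S. S \<subset> I}. \<chi> S)"
proof -
  have sub: "\<chi> ` {S. S \<subset> I} \<subseteq> \<A>"
    using assms(1) by (simp add: image_subset_iff)
  then have "Upper (incl \<A>) (\<chi> ` {S. S \<subset> I}) = {u \<in> \<A>. (\<Union>S\<in>{S. S \<subset> I}. \<chi> S) \<subseteq> u}"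
    unfolding Upper_def incl_simps by blast
  then have "cocartesian I (incl \<A>) \<chi> \<longleftrightarrow>
      \<chi> I \<in> \<A> \<and> (\<Union>S\<in>{S. S \<subset> I}. \<chi> S) \<subseteq> \<chi> I \<and>
      (\<forall>u\<in>\<A>. (\<Union>S\<in>{S. S \<subset> I}. \<chi> S) \<subseteq> u \<longrightarrow> \<chi> I \<subseteq> u)"
    unfolding cocartesian_def least_def by (simp add: Ball_def imp_conjL)
  with assms(2) show ?thesis
    by (metis subset_antisym subset_refl)
qed

text \<open>Two nonempty index sets suffice: a lower bound of all vertices lies below
  \<open>\<chi> S\<close> and \<open>\<chi> T\<close>, hence inside their intersection.\<close>

lemma cartesian_inclI:
  assumes "\<And>S. S \<subseteq> I \<Longrightarrow> \<chi> S \<in> \<A>" and "\<And>S. S \<subseteq> I \<Longrightarrow> \<chi> {} \<subseteq> \<chi> S"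
    and "S \<subseteq> I" "S \<noteq> {}" "T \<subseteq> I" "T \<noteq> {}" "\<chi> S \<inter> \<chi> T \<subseteq> \<chi> {}"
  shows "cartesian I (incl \<A>) \<chi>"
proof -
  have "u \<subseteq> \<chi> {}" if "u \<in> Lower (incl \<A>) (\<chi> ` {S. S \<noteq> {} \<and> S \<subseteq> I})" for u
  proof -
    have "u \<subseteq> \<chi> R" if "R \<subseteq> I" "R \<noteq> {}" for R
      using \<open>u \<in> Lower _ _\<close> that assms(1)[OF \<open>R \<subseteq> I\<close>] unfolding Lower_def incl_simps by blast
    from this[OF assms(3,4)] this[OF assms(5,6)] assms(7) show ?thesis by blast
  qed
  then show ?thesis
    using assms(1)[of "{}"] assms(2) by (auto simp: cartesian_def greatest_def Lower_def)
qed

text \<open>While \<open>B\<close> has at least two indices, the face from \<open>{}\<close> to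
  \<open>B\<close> is cocartesian, so a point of \<open>\<chi> B\<close> already lies in
  \<open>\<chi> S\<close> for some proper subset \<open>S\<close>. Descending by induction ends at a
  set with at most one index.\<close>

lemma strongly_bicartesian_point_at_singleton:
  assumes "finite I" and "card I \<ge> 2" and "cube I (incl (Pow V)) \<chi>"
    and "strongly_bicartesian I (incl (Pow V)) \<chi>" and "v \<in> \<chi> I"
  shows "\<exists>i\<in>I. v \<in> \<chi> {i}"
proof -
  have sub: "\<chi> S \<subseteq> V" if "S \<subseteq> I" for S
    using assms(3) that by (auto simp: cube_def poset_functor_def)
  have mono: "\<chi> S \<subseteq> \<chi> T" if "S \<subseteq> T" "T \<subseteq> I" for S T
    using assms(3) that by (auto simp: cube_def poset_functor_def isotone_def)
  have "\<exists>i\<in>I. v \<in> \<chi> {i}" if "B \<subseteq> I" "v \<in> \<chi> B" for B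
    using finite_subset[OF that(1) assms(1)] that
  proof (induction B rule: finite_psubset_induct)
    case (psubset B)
    show ?case
    proof (cases "card B \<ge> 2")
      case True
      have "cocartesian B (incl (Pow V)) \<chi>"
        using assms(4)[unfolded strongly_bicartesian_def, rule_format, of "{}" B] psubset.prems(1) True
        by (simp add: face_def)
      moreover have in_Pow: "\<chi> S \<in> Pow V" if "S \<subset> B" for S
        using sub that psubset.prems(1) by blast
      moreover from in_Pow have "(\<Union>S\<in>{S. S \<subset> B}. \<chi> S) \<in> Pow V" by blast
      ultimately have "\<chi> B = (\<Union>S\<in>{S. S \<subset> B}. \<chi> S)"
        using cocartesian_incl_iff[of B \<chi> "Pow V"] by simp
      then obtain S where "S \<subset> B" "v \<in> \<chi> S" using psubset.prems(2) by auto
      then show ?thesis using psubset.IH[of S] psubset.prems(1) by auto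
    next
      case False
      \<comment> \<open>The index \<open>i0\<close> covers the case of empty \<open>B\<close>, where
        the point lies in \<open>\<chi> {}\<close> and hence in every vertex.\<close>
      from assms(2) obtain i0 where "i0 \<in> I" by fastforce
      have "card B = 0 \<or> card B = 1" using False by linarith
      then obtain i where "i \<in> I" "B \<subseteq> {i}"
        using psubset.prems(1) psubset.hyps \<open>i0 \<in> I\<close> by (auto simp: card_1_singleton_iff)
      with mono[of B "{i}"] psubset.prems(2) show ?thesis by blast
    qed
  qed
  with assms(5) show ?thesis by blast
qed

text \<open>Direct images preserve unions, and injectivity makes them preserve intersections as
  well. So each face inherits both properties from the corresponding interval of subsets of
  \<open>I\<close>.\<close>

lemma strongly_bicartesian_image:
  assumes "inj_on f I" and "f ` I \<subseteq> V"
  shows "strongly_bicartesian I (incl (Pow V)) ((`) f)"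
  unfolding strongly_bicartesian_def
proof (intro allI impI, elim conjE)
  fix A B assume AB: "A \<subseteq> B" "B \<subseteq> I" "2 \<le> card (B - A)"
  have sub: "face A ((`) f) S \<in> Pow V" if "S \<subseteq> B - A" for S
    using that AB assms(2) unfolding face_def by blast
  \<comment> \<open>Two directions of the face are enough for cartesianness, since
    \<open>insert i A\<close> and \<open>insert j A\<close> meet exactly in
    \<open>A\<close>.\<close>
  obtain i j where ij: "i \<in> B - A" "j \<in> B - A" "i \<noteq> j"
    using AB(3) by (metis obtain_subset_with_card_n card_2_iff insert_subset)
  have "f ` insert i A \<inter> f ` insert j A = f ` (insert i A \<inter> insert j A)"
    using inj_on_image_Int[OF assms(1), of "insert i A" "insert j A"] ij AB by blast
  then have "face A ((`) f) {i} \<inter> face A ((`) f) {j} \<subseteq> face A ((`) f) {}"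
    using ij by (auto simp: face_def)
  then have "cartesian (B - A) (incl (Pow V)) (face A ((`) f))"
    using ij sub by (intro cartesian_inclI[of _ _ _ "{i}" "{j}"]) (auto simp: face_def)
  moreover have "face A ((`) f) (B - A) = (\<Union>S\<in>{S. S \<subset> B - A}. face A ((`) f) S)"
  proof
    show "face A ((`) f) (B - A) \<subseteq> (\<Union>S\<in>{S. S \<subset> B - A}. face A ((`) f) S)"
    proof
      fix v assume "v \<in> face A ((`) f) (B - A)"
      then obtain x where x: "x \<in> A \<union> (B - A)" "v = f x"
        by (auto simp: face_def)
      \<comment> \<open>The index set \<open>{x} \<inter> (B - A)\<close> is \<open>{}\<close> if
        \<open>x\<close> lies in \<open>A\<close> and \<open>{x}\<close> otherwise. It is proper
        because \<open>B - A\<close> contains both \<open>i\<close> and \<open>j\<close>.\<close>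
      have "{x} \<inter> (B - A) \<noteq> B - A"
        using ij by (metis IntE singletonD)
      then have "{x} \<inter> (B - A) \<subset> B - A"
        by blast
      with x show "v \<in> (\<Union>S\<in>{S. S \<subset> B - A}. face A ((`) f) S)"
        unfolding face_def by blast
    qed
  qed (auto simp: face_def)
  then have "cocartesian (B - A) (incl (Pow V)) (face A ((`) f))"
    using sub by (subst cocartesian_incl_iff) blast+
  ultimately show "cartesian (B - A) (incl (Pow V)) (face A ((`) f)) \<and>
      cocartesian (B - A) (incl (Pow V)) (face A ((`) f))" ..
qed

lemma cube_image:
  assumes "finite I" and "f ` I \<subseteq> V"
  shows "cube I (incl (Pow V)) ((`) f)"
  using assms by (auto simp: cube_def poset_functor_def isotone_def
      partial_order.axioms(1)[OF partial_order_incl])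

lemma Union_in_SCplx:
  assumes "\<Y> \<subseteq> SCplx V" and "\<Y> \<noteq> {}"
  shows "\<Union>\<Y> \<in> SCplx V"
  using assms unfolding SCplx_def by blast

text \<open>Joins of complexes are unions, so being cocartesian means that no simplex on the
  terminal vertex is new. Both directions of the theorem use this combinatorial criterion.\<close>

lemma cocartesian_spanned_iff:
  assumes "X \<in> SCplx V" and "I \<noteq> {}" and "\<And>S. S \<subseteq> I \<Longrightarrow> \<chi> S \<subseteq> V"
    and "\<And>S. S \<subseteq> I \<Longrightarrow> \<chi> S \<subseteq> \<chi> I"
  shows "cocartesian I (incl (SCplx V)) (spanned X \<circ> \<chi>) \<longleftrightarrow>
    (\<forall>\<sigma>\<in>X. \<sigma> \<subseteq> \<chi> I \<longrightarrow> (\<exists>S. S \<subset> I \<and> \<sigma> \<subseteq> \<chi> S))"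
proof -
  have in_SCplx: "(spanned X \<circ> \<chi>) S \<in> SCplx V" if "S \<subset> I" for S
    using poset_functor_spanned[OF assms(1)] assms(3)[of S] that
    by (auto simp: poset_functor_def Pi_iff)
  \<comment> \<open>As \<open>I\<close> is nonempty, \<open>{}\<close> is a proper subset of it, so
    the union is over a nonempty family.\<close>
  then have "(\<Union>S\<in>{S. S \<subset> I}. (spanned X \<circ> \<chi>) S) \<in> SCplx V"
    using assms(2) by (intro Union_in_SCplx) auto
  from cocartesian_incl_iff[OF in_SCplx this]
  have "cocartesian I (incl (SCplx V)) (spanned X \<circ> \<chi>) \<longleftrightarrow>
      spanned X (\<chi> I) = (\<Union>S\<in>{S. S \<subset> I}. spanned X (\<chi> S))"
    by (simp add: comp_def)
  moreover have "spanned X (\<chi> S) \<subseteq> spanned X (\<chi> I)" if "S \<subset> I" for S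
    unfolding spanned_def
    using assms(4)[OF psubset_imp_subset[OF that]] by (intro Int_mono Pow_mono subset_refl)
  then have "(\<Union>S\<in>{S. S \<subset> I}. spanned X (\<chi> S)) \<subseteq> spanned X (\<chi> I)"
    by (simp add: UN_subset_iff)
  ultimately have "cocartesian I (incl (SCplx V)) (spanned X \<circ> \<chi>) \<longleftrightarrow>
      spanned X (\<chi> I) \<subseteq> (\<Union>S\<in>{S. S \<subset> I}. spanned X (\<chi> S))"
    by (metis subset_antisym subset_refl)
  also have "\<dots> \<longleftrightarrow> (\<forall>\<sigma>\<in>X. \<sigma> \<subseteq> \<chi> I \<longrightarrow> (\<exists>S. S \<subset> I \<and> \<sigma> \<subseteq> \<chi> S))"
  proof -
    have "Pow U \<inter> X \<subseteq> (\<Union>S\<in>\<S>. Pow (\<chi> S) \<inter> X) \<longleftrightarrow>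
        (\<forall>\<sigma>\<in>X. \<sigma> \<subseteq> U \<longrightarrow> (\<exists>S\<in>\<S>. \<sigma> \<subseteq> \<chi> S))" for U \<S>
      by blast
    then show ?thesis by (simp add: spanned_def)
  qed
  finally show ?thesis .
qed

text \<open>An \<open>i\<close>-simplex has \<open>i + 1\<close> vertices. The bound
  \<open>n \<ge> 1\<close> keeps the natural number \<open>n - 1\<close> from being
  truncated.\<close>

lemma skeletal_iff_card_le:
  assumes "n \<ge> 1"
  shows "skeletal (n - 1) X \<longleftrightarrow> (\<forall>\<sigma>\<in>X. card \<sigma> \<le> n)"
proof
  assume skel: "skeletal (n - 1) X"
  show "\<forall>\<sigma>\<in>X. card \<sigma> \<le> n"
  proof (intro ballI leI notI)
    fix \<sigma> assume "\<sigma> \<in> X" "n < card \<sigma>"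
    then have "simplex (card \<sigma> - 1) X \<sigma>" "card \<sigma> - 1 > n - 1"
      using assms by (auto simp: simplex_def)
    with skel show False unfolding skeletal_def by blast
  qed
qed (auto simp: skeletal_def simplex_def)

theorem mainTheorem8:
  fixes V :: "'a set" and X :: "'a set set" and n :: nat
  assumes "finite V" and "X \<in> SCplx V" and "n \<ge> 1"
  shows "codegree n (incl (Pow V)) (incl (SCplx V)) (spanned X) \<longleftrightarrow> skeletal (n - 1) X"
proof
  assume codeg: "codegree n (incl (Pow V)) (incl (SCplx V)) (spanned X)"
  show "skeletal (n - 1) X"
    unfolding skeletal_iff_card_le[OF assms(3)]
  proof (rule ballI, rule ccontr)
    fix \<rho> assume "\<rho> \<in> X" "\<not> card \<rho> \<le> n"
    \<comment> \<open>Closure of \<open>X\<close> under subsets allows shrinking to exactly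
      \<open>n + 1\<close> vertices, as many as there are indices in \<open>{0..n}\<close>.\<close>
    then obtain \<sigma> where "\<sigma> \<subseteq> \<rho>" and card_\<sigma>: "card \<sigma> = Suc n" and fin: "finite \<sigma>"
      by (metis not_less_eq_eq obtain_subset_with_card_n)
    with \<open>\<rho> \<in> X\<close> assms(2) have \<sigma>: "\<sigma> \<in> X" "\<sigma> \<subseteq> V"
      unfolding SCplx_def by blast+
    obtain f where "bij_betw f {0..n} \<sigma>"
      using finite_same_card_bij[of "{0..n}" \<sigma>] fin card_\<sigma> by auto
    then have f: "inj_on f {0..n}" "f ` {0..n} = \<sigma>"
      by (auto simp: bij_betw_def)
    have "cocartesian {0..n} (incl (SCplx V)) (spanned X \<circ> (`) f)"
      using codeg f \<sigma>(2) strongly_bicartesian_image[of f "{0..n}" V] cube_image[of "{0..n}" f V]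
      unfolding codegree_def by blast
    moreover have "f ` S \<subseteq> V" if "S \<subseteq> {0..n}" for S
      using that f(2) \<sigma>(2) by blast
    ultimately obtain S where "S \<subset> {0..n}" "\<sigma> \<subseteq> f ` S"
      using cocartesian_spanned_iff[OF assms(2), of "{0..n}" "(`) f"] f(2) \<sigma>(1)
      by (auto simp: image_mono)
    \<comment> \<open>Here \<open>\<sigma>\<close> is the image of all of \<open>{0..n}\<close>, so
      by injectivity the image of the proper subset \<open>S\<close> cannot contain it.\<close>
    then show False
      using f inj_on_image_eq_iff[OF f(1), of S "{0..n}"] by blast
  qed
next
  assume "skeletal (n - 1) X"
  then have card_le: "card \<sigma> \<le> n" if "\<sigma> \<in> X" for \<sigma>
    using that skeletal_iff_card_le[OF assms(3)] by blast
  show "codegree n (incl (Pow V)) (incl (SCplx V)) (spanned X)"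
    unfolding codegree_def
  proof (intro conjI allI impI poset_functor_spanned assms(2), elim conjE)
    fix \<chi> :: "nat set \<Rightarrow> 'a set"
    assume cube: "cube {0..n} (incl (Pow V)) \<chi>"
      and bicart: "strongly_bicartesian {0..n} (incl (Pow V)) \<chi>"
    have sub: "\<chi> S \<subseteq> V" if "S \<subseteq> {0..n}" for S
      using cube that by (auto simp: cube_def poset_functor_def)
    have mono: "\<chi> S \<subseteq> \<chi> T" if "S \<subseteq> T" "T \<subseteq> {0..n}" for S T
      using cube that by (auto simp: cube_def poset_functor_def isotone_def)
    have "\<exists>S. S \<subset> {0..n} \<and> \<sigma> \<subseteq> \<chi> S" if \<sigma>: "\<sigma> \<in> X" "\<sigma> \<subseteq> \<chi> {0..n}" for \<sigma>
    proof -
      \<comment> \<open>Since \<open>n \<ge> 1\<close>, the index set \<open>{0..n}\<close> has the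
        two elements that the descent to singletons requires.\<close>
      have "\<forall>v\<in>\<sigma>. \<exists>i\<in>{0..n}. v \<in> \<chi> {i}"
        using strongly_bicartesian_point_at_singleton[OF _ _ cube bicart] \<sigma>(2) assms(3) by auto
      \<comment> \<open>The map \<open>g\<close> chooses one index for each vertex of
        \<open>\<sigma>\<close>. Its image has at most \<open>n\<close> of the \<open>n + 1\<close>
        indices, and by monotonicity \<open>\<chi>\<close> at this image contains all of
        \<open>\<sigma>\<close>.\<close>
      then obtain g where g: "\<And>v. v \<in> \<sigma> \<Longrightarrow> g v \<in> {0..n} \<and> v \<in> \<chi> {g v}"
        by metis
      have "finite \<sigma>"
        using \<sigma>(2) sub[of "{0..n}"] assms(1) by (auto intro: finite_subset)
      then have "card (g ` \<sigma>) \<le> n"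
        using card_image_le[of \<sigma> g] card_le[OF \<sigma>(1)] by linarith
      then have "g ` \<sigma> \<noteq> {0..n}" by auto
      moreover have "g ` \<sigma> \<subseteq> {0..n}" using g by blast
      moreover have "\<sigma> \<subseteq> \<chi> (g ` \<sigma>)"
        using g mono[OF _ \<open>g ` \<sigma> \<subseteq> {0..n}\<close>] by blast
      ultimately show ?thesis by blast
    qed
    then show "cocartesian {0..n} (incl (SCplx V)) (spanned X \<circ> \<chi>)"
      using cocartesian_spanned_iff[OF assms(2), of "{0..n}" \<chi>] sub mono by simp
  qed
qed

end
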